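(* Let $M$ be a coloopless paving matroid. Then $T_M$ is convex along the portion of each line $x+y=p$ lying in the positive quadrant; that is, for all non-negative reals $x_1,x_2,y_1,y_2$ with $x_1+y_1=x_2+y_2$ and all $t$ with $0\le t\le 1$, $$tT_M(x_1,y_1)+(1-t)T_M(x_2,y_2)\ \ge\ T_M\bigl(tx_1+(1-t)x_2,\;ty_1+(1-t)y_2\bigr).$$
   Context: Matroids are finite. For a matroid $M=(E,r)$ with rank function $r$, the Tutte polynomial is $T_M(x,y)=\sum_{A\subseteq E}(x-1)^{r(E)-r(A)}(y-1)^{|A|-r(A)}$. A paving matroid is a matroid all of whose circuits have size at least $r(M)=r(E)$ (loops are thus allowed when the rank is at most 1). A matroid is coloopless if it has no coloop (isthmus), i.e. no element belonging to every basis. *)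

theory Defs
  imports Complex_Main
begin

text \<open>
  Finite matroids presented by a ground set \<open>E\<close> and a rank function \<open>r\<close>. The axioms constrain
  \<open>r\<close> only on subsets of \<open>E\<close>; all notions below evaluate \<open>r\<close> only on such subsets.
\<close>

locale matroid =
  fixes E :: "'a set" and r :: "'a set \<Rightarrow> nat"
  assumes finite_ground: "finite E"
    and rank_le_card: "A \<subseteq> E \<Longrightarrow> r A \<le> card A"
    and rank_mono: "A \<subseteq> B \<Longrightarrow> B \<subseteq> E \<Longrightarrow> r A \<le> r B"
    and rank_submodular:
      "A \<subseteq> E \<Longrightarrow> B \<subseteq> E \<Longrightarrow> r (A \<union> B) + r (A \<inter> B) \<le> r A + r B"
begin

definition indep :: "'a set \<Rightarrow> bool" where
  "indep I \<longleftrightarrow> I \<subseteq> E \<and> r I = card I"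

definition basis :: "'a set \<Rightarrow> bool" where
  "basis B \<longleftrightarrow> indep B \<and> (\<forall>I. indep I \<and> B \<subseteq> I \<longrightarrow> I = B)"

definition circuit :: "'a set \<Rightarrow> bool" where
  "circuit C \<longleftrightarrow> C \<subseteq> E \<and> \<not> indep C \<and> (\<forall>D. D \<subset> C \<longrightarrow> indep D)"

definition coloop :: "'a \<Rightarrow> bool" where
  "coloop e \<longleftrightarrow> e \<in> E \<and> (\<forall>B. basis B \<longrightarrow> e \<in> B)"

definition coloopless :: bool where
  "coloopless \<longleftrightarrow> (\<forall>e\<in>E. \<not> coloop e)"

definition paving :: bool where
  "paving \<longleftrightarrow> (\<forall>C. circuit C \<longrightarrow> r E \<le> card C)"

text \<open>
  By \<open>rank_mono\<close> and \<open>rank_le_card\<close> the natural-number subtractions in the exponents never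
  truncate. The convention \<open>0 ^ 0 = 1\<close> makes this agree with the polynomial at \<open>x = 1\<close> and
  at \<open>y = 1\<close>.
\<close>

definition tutte :: "real \<Rightarrow> real \<Rightarrow> real" where
  "tutte x y = (\<Sum>A\<in>Pow E. (x - 1) ^ (r E - r A) * (y - 1) ^ (card A - r A))"

end

end

theory Submission
  imports Defs "HOL-Analysis.Convex"
begin

text \<open>
  Let the matroid have rank \<open>s + 1\<close> on \<open>n\<close> elements. Since it is paving, only the sets with
  more than \<open>s\<close> elements and rank \<open>s\<close> distinguish its Tutte polynomial from that of the uniform
  matroid, and each of them lies in exactly one dependent hyperplane. This gives
  \<open>T(x, y) = U(x, y) + (x y - x - y) G(y)\<close>, where \<open>U\<close> is the uniform Tutte polynomial and
  \<open>G(y) = \<Sum>j. b j * y ^ j\<close> with \<open>b j = \<Sum>H. (card H - 1 - j) choose s\<close>.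
  The coefficient of \<open>x y\<^bsup>j+1\<^esup>\<close> is \<open>b j - b (j + 1) \<ge> 0\<close> and that of \<open>y\<^bsup>j+2\<^esup>\<close> is
  \<open>(n - 3 - j) choose s - b (j + 1)\<close>. On \<open>x + y = p\<close> the polynomial
  \<open>v x y\<^bsup>j+1\<^esup> + u y\<^bsup>j+2\<^esup>\<close> is convex as soon as \<open>0 \<le> 2 v \<le> (j + 2) u\<close>, so for \<open>j > 0\<close> it
  suffices that \<open>b j \<le> (n - 3 - j) choose s\<close>; for \<open>j = 0\<close> the \<open>x\<^sup>2\<close> term helps, and
  \<open>b 0 \<le> (n - 2) choose s\<close> suffices. Both bounds follow by deleting and contracting an element in
  the set system of dependent hyperplanes, which pairwise meet in fewer than \<open>s\<close> elements and,
  by coloop-freeness, omit at least two elements each.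
\<close>

section \<open>Binomial tails: the pieces of a uniform Tutte polynomial\<close>

lemma sum_Pow_card:
  fixes f :: "nat \<Rightarrow> 'b::comm_semiring_1"
  assumes "finite A"
  shows "(\<Sum>X\<in>Pow A. f (card X)) = (\<Sum>k\<le>card A. of_nat (card A choose k) * f k)"
proof -
  have "(\<Sum>X\<in>Pow A. f (card X)) = (\<Sum>k\<le>card A. \<Sum>X\<in>{X\<in>Pow A. card X = k}. f (card X))"
    using assms by (intro sum.group[symmetric]) (auto intro: card_mono)
  also have "\<dots> = (\<Sum>k\<le>card A. of_nat (card A choose k) * f k)"
    by (intro sum.cong refl) (simp add: Pow_def n_subsets[OF assms])
  finally show ?thesis .
qed

text \<open>The contribution of the sets with more than \<open>s\<close> elements to the Tutte
  polynomial, at \<open>y = z\<close>, of the uniform matroid of rank \<open>s + 1\<close> on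
  \<open>m\<close> elements. The \<open>if\<close> discards smaller sets, for which the truncated
  exponent would give 1.\<close>

definition binomial_tail :: "nat \<Rightarrow> nat \<Rightarrow> real \<Rightarrow> real" where
  "binomial_tail m s z =
    (\<Sum>k\<le>m. real (m choose k) * (if s < k then (z - 1) ^ (k - Suc s) else 0))"

text \<open>Pascal's rule gives two sums. One is the tail itself; in the other, raising
  \<open>k\<close> by one multiplies the weight by \<open>z - 1\<close>, except at
  \<open>k = s\<close>, where the weight jumps from 0 to 1.\<close>

lemma binomial_tail_Suc:
  "binomial_tail (Suc m) s z = z * binomial_tail m s z + real (m choose s)"
proof -
  define f :: "nat \<Rightarrow> real" where "f k = (if s < k then (z - 1) ^ (k - Suc s) else 0)" for k
  have f_Suc: "f (Suc k) = (z - 1) * f k + (if k = s then 1 else 0)" for k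
    by (auto simp: f_def Suc_diff_le Suc_diff_Suc power_Suc[symmetric] simp del: power_Suc)
  have "binomial_tail (Suc m) s z = (\<Sum>k\<le>m. real (Suc m choose Suc k) * f (Suc k))"
    unfolding binomial_tail_def f_def[symmetric] sum.atMost_Suc_shift by (simp add: f_def)
  also have "\<dots> = (\<Sum>k\<le>m. real (m choose k) * f (Suc k)) + (\<Sum>k\<le>m. real (m choose Suc k) * f (Suc k))"
    by (simp add: distrib_right sum.distrib)
  also have "(\<Sum>k\<le>m. real (m choose Suc k) * f (Suc k)) = (\<Sum>k\<le>Suc m. real (m choose k) * f k)"
    unfolding sum.atMost_Suc_shift by (simp add: f_def)
  also have "\<dots> = binomial_tail m s z"
    by (simp add: binomial_tail_def f_def)
  also have "(\<Sum>k\<le>m. real (m choose k) * f (Suc k))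
      = (\<Sum>k\<le>m. (z - 1) * (real (m choose k) * f k) + (if k = s then real (m choose s) else 0))"
    by (intro sum.cong refl) (simp add: f_Suc algebra_simps)
  also have "\<dots> = (z - 1) * binomial_tail m s z + (\<Sum>k\<le>m. if k = s then real (m choose s) else 0)"
    unfolding binomial_tail_def f_def[symmetric] by (simp only: sum.distrib sum_distrib_left)
  also have "(\<Sum>k\<le>m. if k = s then real (m choose s) else 0) = real (m choose s)"
    by (simp add: binomial_eq_0)
  finally show ?thesis by (simp add: algebra_simps)
qed

text \<open>Unrolling the recurrence passes from powers of \<open>z - 1\<close> to powers of
  \<open>z\<close>, where all coefficients are visibly nonnegative.\<close>

lemma binomial_tail_eq:
  "binomial_tail m s z = (\<Sum>j<m. real ((m - Suc j) choose s) * z ^ j)"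
proof (induction m)
  case 0
  show ?case by (simp add: binomial_tail_def)
next
  case (Suc m)
  have "(\<Sum>j<Suc m. real ((Suc m - Suc j) choose s) * z ^ j)
      = real (m choose s) + z * (\<Sum>j<m. real ((m - Suc j) choose s) * z ^ j)"
    unfolding sum.lessThan_Suc_shift by (simp add: sum_distrib_left algebra_simps)
  then show ?case by (simp add: binomial_tail_Suc Suc)
qed

text \<open>Complementation \<open>k \<mapsto> n - k\<close>, that is matroid duality, turns the
  small sets into a tail with parameter \<open>q - 1\<close>. The tail also counts the sets of size
  \<open>Suc s\<close>, each with weight 1; these are subtracted.\<close>

lemma binomial_head_reflect:
  fixes z :: real
  assumes "q > 0"
  shows "(\<Sum>k\<le>s. real ((Suc s + q) choose k) * (z - 1) ^ (Suc s - k))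
    = binomial_tail (Suc s + q) (q - 1) z - real ((Suc s + q) choose Suc s)"
proof -
  define n where "n = Suc s + q"
  have "binomial_tail n (q - 1) z = (\<Sum>k\<in>{q..n}. real (n choose k) * (z - 1) ^ (k - q))"
    unfolding binomial_tail_def using assms
    by (intro sum.mono_neutral_cong_right) auto
  also have "\<dots> = (\<Sum>k\<le>Suc s. real (n choose k) * (z - 1) ^ (Suc s - k))"
    by (rule sum.reindex_bij_witness[of _ "\<lambda>k. n - k" "\<lambda>k. n - k"])
      (auto simp: n_def binomial_symmetric[symmetric] intro!: arg_cong2[where f="(*)"] arg_cong[where f="\<lambda>k. _ ^ k"]
        arg_cong[where f=real] binomial_symmetric)
  finally show ?thesis by (simp add: n_def)
qed

section \<open>Convexity along a line \<open>x + y = p\<close>\<close>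

lemma convex_on_reflected_power:
  "convex_on {0..p} (\<lambda>y::real. (p - y) ^ i)"
  by (rule f''_ge0_imp_convex[where f'="\<lambda>y. - (real i * (p - y) ^ (i - 1))"
        and f''="\<lambda>y. real i * (real (i - 1) * (p - y) ^ (i - 1 - 1))"])
    (auto intro!: derivative_eq_intros mult_nonneg_nonneg)

lemma convex_on_mixed_term:
  fixes u v p :: real
  assumes "0 \<le> v" "2 * v \<le> (real j + 2) * u"
  shows "convex_on {0..p} (\<lambda>y. u * y ^ (j + 2) + v * ((p - y) * y ^ (j + 1)))"
proof -
  let ?f0 = "\<lambda>y. (u - v) * y ^ (j + 2) + v * p * y ^ (j + 1)"
  let ?f1 = "\<lambda>y. (u - v) * ((real j + 2) * y ^ (j + 1)) + v * p * ((real j + 1) * y ^ j)"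
  let ?f2 = "\<lambda>y. (u - v) * ((real j + 2) * ((real j + 1) * y ^ j)) + v * p * ((real j + 1) * (real j * y ^ (j - 1)))"
  have "convex_on {0..p} ?f0"
  proof (rule f''_ge0_imp_convex)
    fix y assume y: "y \<in> {0..p}"
    show "(?f0 has_real_derivative ?f1 y) (at y)"
      by (rule derivative_eq_intros refl | simp add: ac_simps)+
    show "(?f1 has_real_derivative ?f2 y) (at y)"
      by (rule derivative_eq_intros refl | simp add: ac_simps)+
    \<comment> \<open>Substituting \<open>p = y + (p - y)\<close> in the last summand makes both
      coefficients nonnegative. The case \<open>j = 0\<close> is separate because the exponent
      \<open>j - 1\<close> truncates there, with coefficient 0.\<close>
    have "?f2 y = (real j + 1) * (((real j + 2) * u - 2 * v) * y ^ j + v * real j * y ^ (j - 1) * (p - y))"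
      by (cases j) (simp_all add: algebra_simps)
    also have "\<dots> \<ge> 0"
      using assms y by (auto intro!: mult_nonneg_nonneg add_nonneg_nonneg)
    finally show "0 \<le> ?f2 y" .
  qed simp
  moreover have "?f0 = (\<lambda>y. u * y ^ (j + 2) + v * ((p - y) * y ^ (j + 1)))"
    by (simp add: algebra_simps)
  ultimately show ?thesis by simp
qed

lemma convex_on_quadratic:
  fixes a b c :: real
  assumes "0 \<le> a" "convex S"
  shows "convex_on S (\<lambda>y. a * y ^ 2 + b * y + c)"
  by (rule f''_ge0_imp_convex[where f'="\<lambda>y. 2 * a * y + b" and f''="\<lambda>y. 2 * a"])
    (use assms in \<open>auto intro!: derivative_eq_intros\<close>)

lemma convex_on_sum_functions:
  fixes f :: "'i \<Rightarrow> 'a::real_vector \<Rightarrow> real"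
  assumes "finite I" "convex S" "\<And>i. i \<in> I \<Longrightarrow> convex_on S (f i)"
  shows "convex_on S (\<lambda>x. \<Sum>i\<in>I. f i x)"
  using assms by (induction I rule: finite_induct) (auto simp: convex_on_const)

text \<open>Here \<open>x = p - y\<close>, the numbers \<open>w\<close>, \<open>u\<close> are the
  coefficients of \<open>x^(i+2)\<close>, \<open>y^(j+2)\<close> in the uniform part, and
  \<open>b\<close> those of the hyperplane polynomial. Expanding the product leaves a part of degree
  at most 2, higher powers of \<open>x\<close>, and mixed terms, each convex on its own.\<close>

lemma convex_on_paving_form:
  fixes b u w :: "nat \<Rightarrow> real"
  assumes dec: "\<And>j. b (Suc j) \<le> b j" and bN: "b N = 0"
    and bu: "\<And>j. 0 < j \<Longrightarrow> j < N \<Longrightarrow> b j \<le> u j"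
    and buw: "0 < N \<Longrightarrow> b 0 \<le> u 0 + w 0"
    and w: "\<And>i. 0 \<le> w i"
  shows "convex_on {0..p} (\<lambda>y. (c0 + c1 * (p - y) + (\<Sum>i<N. w i * (p - y) ^ (i + 2)))
      + (d0 + d1 * y + (\<Sum>j<N. u j * y ^ (j + 2)))
      + ((p - y) * y - (p - y) - y) * (\<Sum>j<N. b j * y ^ j))"
proof (cases N)
  case 0
  have "convex_on {0..p} (\<lambda>y. 0 * y ^ 2 + (d1 - c1) * y + (c0 + c1 * p + d0))"
    by (rule convex_on_quadratic) auto
  then show ?thesis by (simp add: 0 algebra_simps)
next
  case (Suc M)
  \<comment> \<open>With \<open>x = p - y\<close>, the leading coefficient collects
    \<open>w 0\<close> from \<open>x^2\<close>, \<open>u 0 - b 1\<close> from \<open>y^2\<close> and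
    \<open>-(b 0 - b 1)\<close> from \<open>x y\<close>. This is why only
    \<open>b 0 \<le> u 0 + w 0\<close> is required at index 0.\<close>
  let ?quad = "\<lambda>y. (w 0 + (u 0 - b 0)) * y ^ 2 + (d1 - c1 - 2 * w 0 * p + (b 0 - b 1) * p) * y
    + (c0 + c1 * p + d0 + w 0 * p ^ 2 - b 0 * p)"
  let ?pow = "\<lambda>y. \<Sum>i<M. w (Suc i) * (p - y) ^ (i + 3)"
  let ?mix = "\<lambda>y. \<Sum>j<M. (u (Suc j) - b (Suc (Suc j))) * y ^ (Suc j + 2)
    + (b (Suc j) - b (Suc (Suc j))) * ((p - y) * y ^ (Suc j + 1))"
  have quad: "convex_on {0..p} ?quad"
    using buw Suc by (intro convex_on_quadratic) auto
  have pow: "convex_on {0..p} ?pow"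
    using w by (intro convex_on_sum_functions convex_on_cmul convex_on_reflected_power) auto
  have mix: "convex_on {0..p} ?mix"
  proof (intro convex_on_sum_functions convex_on_mixed_term)
    fix j assume "j \<in> {..<M}"
    then have "b (Suc j) \<le> u (Suc j)" using bu Suc by simp
    moreover have "b (Suc (Suc j)) \<le> b (Suc j)" by (rule dec)
    moreover from calculation have "real j * (u (Suc j) - b (Suc (Suc j))) \<ge> 0" by simp
    ultimately show "2 * (b (Suc j) - b (Suc (Suc j))) \<le> (real (Suc j) + 2) * (u (Suc j) - b (Suc (Suc j)))"
      by (simp add: algebra_simps)
  qed (auto simp: dec)
  have "convex_on {0..p} (\<lambda>y. ?quad y + ?pow y + ?mix y)"
    by (rule convex_on_add[OF convex_on_add[OF quad pow] mix])
  also have "(\<lambda>y. ?quad y + ?pow y + ?mix y) = (\<lambda>y. (c0 + c1 * (p - y) + (\<Sum>i<N. w i * (p - y) ^ (i + 2)))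
      + (d0 + d1 * y + (\<Sum>j<N. u j * y ^ (j + 2)))
      + ((p - y) * y - (p - y) - y) * (\<Sum>j<N. b j * y ^ j))"
  proof
    fix y
    define B where "B = (\<Sum>j<M. b (Suc j) * y ^ j)"
    define B' where "B' = (\<Sum>j<M. b (Suc (Suc j)) * y ^ j)"
    define U where "U = (\<Sum>j<M. u (Suc j) * y ^ (j + 3))"
    have sumb: "(\<Sum>j<N. b j * y ^ j) = b 0 + y * B"
      unfolding Suc sum.lessThan_Suc_shift B_def by (simp add: sum_distrib_left algebra_simps)
    \<comment> \<open>The extra top term is \<open>b N\<close>, which vanishes.\<close>
    have "(\<Sum>j<Suc M. b (Suc j) * y ^ j) = B"
      using bN Suc by (simp add: B_def)
    then have BB': "B = b 1 + y * B'"
      unfolding sum.lessThan_Suc_shift B'_def by (simp add: sum_distrib_left algebra_simps)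
    have mix: "?mix y = U - y ^ 3 * B' + (p - y) * y ^ 2 * (B - B')"
      by (simp add: U_def B_def B'_def sum_distrib_left sum_subtractf[symmetric] sum.distrib[symmetric]
          algebra_simps power_add eval_nat_numeral)
    have sumw: "(\<Sum>i<N. w i * (p - y) ^ (i + 2)) = w 0 * (p - y) ^ 2 + ?pow y"
      unfolding Suc sum.lessThan_Suc_shift by (simp add: eval_nat_numeral)
    have sumu: "(\<Sum>j<N. u j * y ^ (j + 2)) = u 0 * y ^ 2 + U"
      unfolding Suc sum.lessThan_Suc_shift by (simp add: U_def eval_nat_numeral)
    show "?quad y + ?pow y + ?mix y = (c0 + c1 * (p - y) + (\<Sum>i<N. w i * (p - y) ^ (i + 2)))
      + (d0 + d1 * y + (\<Sum>j<N. u j * y ^ (j + 2)))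
      + ((p - y) * y - (p - y) - y) * (\<Sum>j<N. b j * y ^ j)"
      unfolding mix sumw sumu sumb BB' by (simp add: algebra_simps power2_eq_square power3_eq_cube)
  qed
  finally show ?thesis .
qed

section \<open>A bound for set systems with small pairwise intersections\<close>

text \<open>Induction on the ground set: deleting \<open>e\<close> keeps \<open>s\<close>,
  contracting \<open>e\<close> lowers \<open>s\<close> by one, and Pascal's rule adds the two
  bounds. The induction stops when \<open>s = 0\<close> or some member has the maximal size allowed
  by \<open>d\<close>.\<close>

lemma sum_binomial_almost_disjoint_le:
  fixes \<H> :: "'a set set"
  assumes "finite E" "\<And>H. H \<in> \<H> \<Longrightarrow> H \<subseteq> E"
    and "\<And>H. H \<in> \<H> \<Longrightarrow> s + j \<le> card H" "\<And>H. H \<in> \<H> \<Longrightarrow> card H + d \<le> card E"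
    and "d \<le> j"
    and "\<And>H K. H \<in> \<H> \<Longrightarrow> K \<in> \<H> \<Longrightarrow> H \<noteq> K \<Longrightarrow> card (H \<inter> K) < s"
  shows "(\<Sum>H\<in>\<H>. (card H - j) choose s) \<le> (card E - d - j) choose s"
  using assms(1-4,6)
proof (induction E arbitrary: \<H> s rule: finite_induct)
  case empty
  show ?case
  proof (cases "\<H> = {}")
    case False
    then have "\<H> = {{}}" using empty(1) by fastforce
    then show ?thesis using empty(2) by simp
  qed simp
next
  case (insert e E)
  note sub = insert.prems(1) and large = insert.prems(2) and small = insert.prems(3)
    and inter = insert.prems(4)
  have fin: "finite H" if "H \<in> \<H>" for H
    using sub[OF that] insert.hyps(1) by (meson finite.insertI finite_subset)
  have finH: "finite \<H>"
    using sub insert.hyps(1) by (meson Pow_iff finite.insertI finite_Pow_iff finite_subset subsetI)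
  show ?case
  proof (cases "\<exists>H0\<in>\<H>. s = 0 \<or> card H0 + d = card (insert e E)")
    case True
    then obtain H0 where H0: "H0 \<in> \<H>" and H0': "s = 0 \<or> card H0 + d = card (insert e E)"
      by blast
    \<comment> \<open>A second member \<open>K\<close> would have fewer than \<open>s + d\<close>
      elements, by counting \<open>K \<union> H0\<close> and \<open>K \<inter> H0\<close>; as
      \<open>d \<le> j\<close>, this contradicts \<open>s + j \<le> card K\<close>. For
      \<open>s = 0\<close> no intersection can have fewer than \<open>s\<close> elements.\<close>
    have "K = H0" if K: "K \<in> \<H>" for K
    proof (rule ccontr)
      assume "K \<noteq> H0"
      then have *: "card (K \<inter> H0) < s" using inter K H0 by blast
      have "card K + card H0 = card (K \<union> H0) + card (K \<inter> H0)"
        by (intro card_Un_Int fin K H0)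
      moreover have "card (K \<union> H0) \<le> card (insert e E)"
        using sub[OF K] sub[OF H0] insert.hyps(1) by (intro card_mono) auto
      ultimately show False
        using * H0' large[OF K] \<open>d \<le> j\<close> by linarith
    qed
    then have "\<H> = {H0}" using H0 by blast
    then show ?thesis
      using small[OF H0] by (simp add: binomial_right_mono diff_le_mono le_diff_conv2)
  next
    case False
    then have less: "card H + d < card (insert e E)" if "H \<in> \<H>" for H
      using small[OF that] that by fastforce
    show ?thesis
    proof (cases "\<H> = {}")
      case False
      then obtain s' where s': "s = Suc s'"
        using \<open>\<not> (\<exists>H0\<in>\<H>. _)\<close> not0_implies_Suc by blast
      \<comment> \<open>The deletion \<open>D\<close> keeps only sets that are still large enough;
        the dropped ones have binomial coefficient 0. The contraction \<open>C\<close> needs no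
        filter, since \<open>s\<close> drops along with the size.\<close>
      define D where "D = {H - {e} |H. H \<in> \<H> \<and> s + j \<le> card (H - {e})}"
      define C where "C = {H - {e} |H. H \<in> \<H> \<and> e \<in> H}"
      have cardm: "card (H - {e}) = (if e \<in> H then card H - 1 else card H)" for H :: "'a set"
        by simp
      have int_le: "card ((H - {e}) \<inter> (K - {e})) \<le> card (H \<inter> K)" if "H \<in> \<H>" "K \<in> \<H>" for H K
        using fin that by (intro card_mono) auto
      \<comment> \<open>A common trace has fewer than \<open>s\<close> elements while both sets have
        at least \<open>s\<close>, so both contain \<open>e\<close> and hence coincide.\<close>
      have inj: "inj_on (\<lambda>H. H - {e}) \<H>"
      proof (rule inj_onI, rule ccontr)
        fix H K assume HK: "H \<in> \<H>" "K \<in> \<H>" "H - {e} = K - {e}" "H \<noteq> K"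
        have "card (H - {e}) \<le> card (H \<inter> K)"
          using int_le[OF HK(1,2)] HK(3) by simp
        moreover have "card (H \<inter> K) < s" using inter HK by blast
        moreover have "s + j \<le> card H" "s + j \<le> card K" using large HK by auto
        moreover have "card H \<le> Suc (card (H - {e}))" "card K \<le> Suc (card (K - {e}))"
          unfolding cardm by auto
        moreover have "card (H - {e}) = card (K - {e})" using HK(3) by simp
        ultimately have "card (H - {e}) < card H" "card (K - {e}) < card K"
          by linarith+
        then have "e \<in> H" "e \<in> K" by (auto simp: cardm split: if_splits)
        then show False using HK(3,4) by blast
      qed
      have D: "(\<Sum>H\<in>D. (card H - j) choose s) \<le> (card E - d - j) choose s"
      proof (rule insert.IH)
        show "card H + d \<le> card E" if "H \<in> D" for H
          using that less insert.hyps by (fastforce simp: D_def cardm split: if_splits)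
        show "card (H \<inter> K) < s" if HK: "H \<in> D" "K \<in> D" "H \<noteq> K" for H K
        proof -
          obtain H' K' where *: "H = H' - {e}" "K = K' - {e}" "H' \<in> \<H>" "K' \<in> \<H>"
            using HK(1,2) unfolding D_def by blast
          then have "card (H' \<inter> K') < s" using inter HK(3) by blast
          then show ?thesis using int_le[OF *(3,4)] *(1,2) by (metis le_less_trans)
        qed
      qed (use sub in \<open>auto simp: D_def\<close>)
      have C: "(\<Sum>H\<in>C. (card H - j) choose s') \<le> (card E - d - j) choose s'"
      proof (rule insert.IH)
        show "s' + j \<le> card H" if "H \<in> C" for H
          using that large by (fastforce simp: C_def s')
        show "card H + d \<le> card E" if "H \<in> C" for H
          using that less insert.hyps by (fastforce simp: C_def)
        show "card (H \<inter> K) < s'" if HK: "H \<in> C" "K \<in> C" "H \<noteq> K" for H K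
        proof -
          obtain H' K' where *: "H = H' - {e}" "K = K' - {e}" "H' \<in> \<H>" "K' \<in> \<H>" "e \<in> H'" "e \<in> K'"
            using HK(1,2) unfolding C_def by blast
          then have "H \<inter> K = (H' \<inter> K') - {e}" by auto
          then have "Suc (card (H \<inter> K)) = card (H' \<inter> K')"
            using * fin by (metis IntI card_Suc_Diff1 finite_Int)
          moreover have "card (H' \<inter> K') < s" using inter * HK(3) by blast
          ultimately show ?thesis using s' by simp
        qed
      qed (use sub in \<open>auto simp: C_def\<close>)
      have "(\<Sum>H\<in>\<H>. (card H - j) choose s)
          = (\<Sum>H\<in>\<H>. (if s + j \<le> card (H - {e}) then (card (H - {e}) - j) choose s else 0)
              + (if e \<in> H then (card (H - {e}) - j) choose s' else 0))"
      proof (rule sum.cong)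
        fix H assume H: "H \<in> \<H>"
        show "(card H - j) choose s
          = (if s + j \<le> card (H - {e}) then (card (H - {e}) - j) choose s else 0)
              + (if e \<in> H then (card (H - {e}) - j) choose s' else 0)"
        proof (cases "e \<in> H")
          case True
          then have "card H = Suc (card (H - {e}))" using card_Suc_Diff1[OF fin[OF H], of e] by metis
          moreover from this have "card H - j = Suc (card (H - {e}) - j)"
            using large[OF H] s' by linarith
          ultimately show ?thesis using True large[OF H] s'
            by (auto simp: binomial_eq_0 simp del: card_Diff_insert)
        next
          case False
          then show ?thesis using large[OF H] by simp
        qed
      qed simp
      also have "\<dots> = (\<Sum>H\<in>D. (card H - j) choose s) + (\<Sum>H\<in>C. (card H - j) choose s')"
      proof -
        have "D = (\<lambda>H. H - {e}) ` {H\<in>\<H>. s + j \<le> card (H - {e})}"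
          "C = (\<lambda>H. H - {e}) ` {H\<in>\<H>. e \<in> H}"
          by (auto simp: D_def C_def)
        then show ?thesis
          using inj by (simp add: sum.reindex inj_on_subset sum.distrib sum.inter_filter finH del: card_Diff_insert)
      qed
      also have "\<dots> \<le> ((card E - d - j) choose s) + ((card E - d - j) choose s')"
        using C D by (rule add_mono[rotated])
      also have "\<dots> = (card (insert e E) - d - j) choose s"
      proof -
        obtain H where H: "H \<in> \<H>" using False by blast
        have "card (insert e E) - d - j = Suc (card E - d - j)"
          using less[OF H] large[OF H] s' insert.hyps by simp
        then show ?thesis by (simp add: s')
      qed
      finally show ?thesis .
    qed simp
  qed
qed

section \<open>Rank, bases, coloops and small sets\<close>

text \<open>Elements of \<open>X\<close> are added one at a time, with submodularity applied to
  \<open>B \<union> X\<close> and \<open>insert e B\<close>, whose intersection contains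
  \<open>B\<close>. Contraposed, it is the augmentation step.\<close>

lemma (in matroid) rank_Un_le:
  assumes "finite X" "X \<subseteq> E" "B \<subseteq> E" "\<And>e. e \<in> X \<Longrightarrow> r (insert e B) \<le> r B"
  shows "r (B \<union> X) \<le> r B"
  using assms
proof (induction X rule: finite_induct)
  case (insert e X)
  have "r ((B \<union> X) \<union> insert e B) + r ((B \<union> X) \<inter> insert e B) \<le> r (B \<union> X) + r (insert e B)"
    using insert.prems by (intro rank_submodular) auto
  moreover have "r B \<le> r ((B \<union> X) \<inter> insert e B)"
    using insert.prems by (intro rank_mono) auto
  moreover have "r (B \<union> X) \<le> r B" "r (insert e B) \<le> r B"
    using insert by auto
  moreover have "(B \<union> X) \<union> insert e B = B \<union> insert e X" by auto
  ultimately show ?case by simp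
qed simp

text \<open>A basis of deficient rank would admit an element raising the rank, and adding it would
  keep the set independent, against maximality.\<close>

lemma (in matroid) basis_rank:
  assumes "basis B"
  shows "r B = r E"
proof (rule ccontr)
  assume neq: "r B \<noteq> r E"
  have B: "B \<subseteq> E" "r B = card B" and max: "\<And>I. indep I \<Longrightarrow> B \<subseteq> I \<Longrightarrow> I = B"
    using assms by (auto simp: basis_def indep_def)
  have "r B \<le> r E" using B by (intro rank_mono) auto
  then have "\<not> r (B \<union> E) \<le> r B" using neq B by (simp add: Un_absorb1)
  then obtain e where e: "e \<in> E" "r B < r (insert e B)"
    using rank_Un_le[OF finite_ground subset_refl B(1)] by (meson not_le)
  have "r (insert e B) \<le> card (insert e B)" using e B by (intro rank_le_card) auto
  moreover have "card (insert e B) \<le> Suc (card B)" by (simp add: card_insert_if finite_subset[OF B(1) finite_ground])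
  ultimately have "indep (insert e B)" using e B by (auto simp: indep_def)
  then have "insert e B = B" by (rule max) auto
  then show False using e by simp
qed

lemma (in matroid) coloopless_rank_delete:
  assumes "coloopless" "e \<in> E"
  shows "r (E - {e}) = r E"
proof -
  obtain B where B: "basis B" "e \<notin> B"
    using assms by (auto simp: coloopless_def coloop_def)
  then have "B \<subseteq> E - {e}" by (auto simp: basis_def indep_def)
  then have "r B \<le> r (E - {e})" by (intro rank_mono) auto
  moreover have "r (E - {e}) \<le> r E" by (intro rank_mono) auto
  ultimately show ?thesis using basis_rank[OF B(1)] by simp
qed

lemma (in matroid) coloopless_rank_less_card:
  assumes "coloopless" "0 < r E"
  shows "r E < card E"
proof -
  have "E \<noteq> {}" using assms(2) rank_le_card[of "{}"] by auto
  then obtain e where e: "e \<in> E" by blast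
  have "r E \<le> card (E - {e})"
    using rank_le_card[of "E - {e}"] coloopless_rank_delete[OF assms(1) e] by auto
  also have "\<dots> < card E" using e finite_ground by (rule card_Diff1_less[rotated])
  finally show ?thesis .
qed

text \<open>Otherwise a minimal dependent subset of \<open>A\<close> would be a circuit with fewer
  than \<open>r E\<close> elements.\<close>

lemma (in matroid) paving_rank_small:
  assumes "paving" "A \<subseteq> E" "card A < r E"
  shows "r A = card A"
proof (rule ccontr)
  assume neq: "r A \<noteq> card A"
  have finA: "finite A" using assms(2) finite_ground finite_subset by blast
  have "finite {X. X \<subseteq> A \<and> \<not> indep X}" "A \<in> {X. X \<subseteq> A \<and> \<not> indep X}"
    using finA neq by (auto simp: indep_def)
  from finite_has_minimal2[OF this]
  obtain C where C: "C \<subseteq> A" "\<not> indep C" and min: "\<And>D. D \<subseteq> A \<Longrightarrow> \<not> indep D \<Longrightarrow> D \<subseteq> C \<Longrightarrow> C = D"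
    by auto
  have "circuit C"
    unfolding circuit_def using C min assms(2) by blast
  then have "r E \<le> card C" using assms(1) by (simp add: paving_def)
  also have "card C \<le> card A" using C finA by (intro card_mono)
  finally show False using assms(3) by simp
qed

section \<open>Dependent hyperplanes\<close>

text \<open>Flatness is encoded as maximality among the sets of the same rank, which avoids a
  closure operator.\<close>

definition (in matroid) dependent_hyperplane :: "'a set \<Rightarrow> bool" where
  "dependent_hyperplane H \<longleftrightarrow> H \<subseteq> E \<and> Suc (r H) = r E \<and> r H < card H
    \<and> (\<forall>K. H \<subseteq> K \<and> K \<subseteq> E \<and> r K = r H \<longrightarrow> K = H)"

lemma (in matroid) finite_dependent_hyperplanes: "finite {H. dependent_hyperplane H}"
  by (rule finite_subset[of _ "Pow E"]) (auto simp: dependent_hyperplane_def finite_ground)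

text \<open>By submodularity, a common subset of rank at least \<open>r E - 1\<close> keeps the rank
  of \<open>H \<union> K\<close> at \<open>r E - 1\<close>, so maximality identifies both sets with
  the union.\<close>

lemma (in matroid) dependent_hyperplane_unique:
  assumes "dependent_hyperplane H" "dependent_hyperplane K" "A \<subseteq> H \<inter> K" "r E \<le> Suc (r A)"
  shows "H = K"
proof -
  have HK: "H \<subseteq> E" "K \<subseteq> E" "Suc (r H) = r E" "Suc (r K) = r E"
    using assms by (auto simp: dependent_hyperplane_def)
  have "r (H \<union> K) + r (H \<inter> K) \<le> r H + r K" by (intro rank_submodular HK)
  moreover have "r A \<le> r (H \<inter> K)" using HK assms(3) by (intro rank_mono) auto
  moreover have "r H \<le> r (H \<union> K)" using HK by (intro rank_mono) auto
  ultimately have "r (H \<union> K) = r H" "r (H \<union> K) = r K" using HK assms(4) by linarith+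
  then have "H \<union> K = H" "H \<union> K = K"
    using assms(1,2) unfolding dependent_hyperplane_def by (meson Un_least Un_upper1 Un_upper2)+
  then show ?thesis by simp
qed

text \<open>A larger intersection would contain a set of \<open>r E - 1\<close> elements,
  independent by paving, and uniqueness would apply.\<close>

lemma (in matroid) dependent_hyperplane_inter:
  assumes "paving" "dependent_hyperplane H" "dependent_hyperplane K" "H \<noteq> K"
  shows "Suc (card (H \<inter> K)) < r E"
proof (rule ccontr)
  assume "\<not> ?thesis"
  moreover have rH: "Suc (r H) = r E" using assms(2) by (simp add: dependent_hyperplane_def)
  ultimately have "r H \<le> card (H \<inter> K)" by simp
  then obtain A where A: "A \<subseteq> H \<inter> K" "card A = r H"
    by (meson obtain_subset_with_card_n)
  have "r A = card A"
    using A rH assms(2) by (intro paving_rank_small assms(1)) (auto simp: dependent_hyperplane_def)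
  then show False
    using dependent_hyperplane_unique[OF assms(2,3) A(1)] A(2) rH assms(4) by simp
qed

lemma (in matroid) obtain_dependent_hyperplane:
  assumes "A \<subseteq> E" "Suc (r A) = r E" "r A < card A"
  obtains H where "dependent_hyperplane H" "A \<subseteq> H"
proof -
  have "finite {X. X \<subseteq> E \<and> r X = r A}" "A \<in> {X. X \<subseteq> E \<and> r X = r A}"
    using finite_ground assms by auto
  from finite_has_maximal2[OF this]
  obtain H where H: "H \<subseteq> E" "r H = r A" "A \<subseteq> H"
    and max: "\<And>K. K \<subseteq> E \<Longrightarrow> r K = r A \<Longrightarrow> H \<subseteq> K \<Longrightarrow> H = K"
    by auto
  have "card A \<le> card H" using H finite_ground by (intro card_mono) (auto intro: finite_subset)
  then have "dependent_hyperplane H"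
    using H max assms unfolding dependent_hyperplane_def by auto
  with H(3) show thesis by (rule that[rotated])
qed

text \<open>A hyperplane missing a single element \<open>e\<close> would be \<open>E - {e}\<close>,
  which has full rank when \<open>e\<close> is not a coloop.\<close>

lemma (in matroid) dependent_hyperplane_card:
  assumes "coloopless" "dependent_hyperplane H"
  shows "card H + 2 \<le> card E"
proof (rule ccontr)
  assume neg: "\<not> ?thesis"
  have H: "H \<subseteq> E" "Suc (r H) = r E" using assms(2) by (auto simp: dependent_hyperplane_def)
  have card: "card (E - H) = card E - card H"
    using H finite_ground by (meson card_Diff_subset finite_subset)
  have "H \<noteq> E" using H by auto
  then obtain e where e: "e \<in> E" "e \<notin> H" using H by blast
  have "card (E - H) \<le> Suc 0" using neg card by linarith
  then have "E - H = {e}"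
    using e finite_ground card_le_Suc0_iff_eq[of "E - H"] by auto
  then have "E - {e} = H" using H e by blast
  then show False using coloopless_rank_delete[OF assms(1) e(1)] H by simp
qed

section \<open>The Tutte polynomial of a paving matroid\<close>

text \<open>Sets with at most \<open>s\<close> elements are independent, and larger ones have rank
  \<open>s\<close> or \<open>s + 1\<close>. Those of rank \<open>s\<close>, collected in
  \<open>\<D>\<close>, are the only deviation from the uniform matroid and are grouped by the unique
  dependent hyperplane containing each.\<close>

lemma (in matroid) tutte_paving:
  assumes "paving" and rank: "r E = Suc s" and card: "card E = Suc s + q" and "0 < q"
  shows "tutte x y = binomial_tail (card E) (q - 1) x - real (card E choose Suc s)
    + binomial_tail (card E) s y
    + (x * y - x - y) * (\<Sum>H | dependent_hyperplane H. binomial_tail (card H) s y)"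
proof -
  define f where "f k = (if s < k then (y - 1) ^ (k - Suc s) else 0)" for k
  define g where "g k = (if k \<le> s then (x - 1) ^ (Suc s - k) else 0)" for k
  define \<D> where "\<D> = {A \<in> Pow E. r A = s \<and> s < card A}"
  have fin: "finite S" if "S \<subseteq> E" for S
    using that finite_ground by (rule finite_subset)
  have tail: "(\<Sum>A\<in>Pow S. f (card A)) = binomial_tail (card S) s y" if "S \<subseteq> E" for S
    using sum_Pow_card[of S f] that finite_ground
    by (simp add: finite_subset binomial_tail_def f_def)
  have head: "(\<Sum>A\<in>Pow E. g (card A)) = binomial_tail (card E) (q - 1) x - real (card E choose Suc s)"
  proof -
    have "(\<Sum>A\<in>Pow E. g (card A)) = (\<Sum>k\<le>card E. real (card E choose k) * g k)"
      by (simp add: sum_Pow_card finite_ground)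
    also have "\<dots> = (\<Sum>k\<le>s. real (card E choose k) * (x - 1) ^ (Suc s - k))"
      by (rule sum.mono_neutral_cong_right) (auto simp: g_def card)
    finally show ?thesis using binomial_head_reflect[OF \<open>0 < q\<close>, of s x] card by simp
  qed
  have lower: "s \<le> r A" if A: "A \<subseteq> E" "s \<le> card A" for A
  proof -
    obtain S where "S \<subseteq> A" "card S = s" using A(2) by (meson obtain_subset_with_card_n)
    then show ?thesis
      using paving_rank_small[OF assms(1), of S] rank rank_mono[of S A] A(1) by auto
  qed
  have "(x - 1) ^ (r E - r A) * (y - 1) ^ (card A - r A)
      = g (card A) + f (card A) + (if A \<in> \<D> then (x * y - x - y) * f (card A) else 0)"
    if A: "A \<in> Pow E" for A
  proof (cases "card A \<le> s")
    case True
    then have "r A = card A" using paving_rank_small[OF assms(1), of A] A rank by auto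
    then show ?thesis using True rank by (simp add: f_def g_def \<D>_def)
  next
    case False
    then have "s \<le> r A" "r A \<le> Suc s" using lower[of A] A rank rank_mono[of A E] by auto
    then consider "r A = s" | "r A = Suc s" by linarith
    then show ?thesis
    proof cases
      case 1
      \<comment> \<open>Such a set contributes \<open>(x - 1) * (y - 1)\<close> times its uniform
        weight, and \<open>(x - 1) * (y - 1) - 1 = x * y - x - y\<close> is the correction
        factor.\<close>
      have "card A - s = Suc (card A - Suc s)" using False by simp
      then show ?thesis using 1 False A rank by (simp add: f_def g_def \<D>_def algebra_simps)
    next
      case 2
      then show ?thesis using False rank by (simp add: f_def g_def \<D>_def)
    qed
  qed
  then have "tutte x y = (\<Sum>A\<in>Pow E. g (card A)) + (\<Sum>A\<in>Pow E. f (card A))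
      + (\<Sum>A\<in>Pow E. if A \<in> \<D> then (x * y - x - y) * f (card A) else 0)"
    unfolding tutte_def by (simp add: sum.distrib)
  also have "(\<Sum>A\<in>Pow E. if A \<in> \<D> then (x * y - x - y) * f (card A) else 0)
      = (x * y - x - y) * (\<Sum>A\<in>\<D>. f (card A))"
  proof -
    have "{A \<in> Pow E. A \<in> \<D>} = \<D>" by (auto simp: \<D>_def)
    then show ?thesis using sum.inter_filter[of "Pow E" "\<lambda>A. (x * y - x - y) * f (card A)" "\<lambda>A. A \<in> \<D>"]
      by (simp add: finite_ground sum_distrib_left)
  qed
  also have "(\<Sum>A\<in>\<D>. f (card A))
      = (\<Sum>A\<in>(\<Union>H\<in>{H. dependent_hyperplane H}. {A\<in>Pow H. s < card A}). f (card A))"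
  proof (rule sum.cong)
    show "\<D> = (\<Union>H\<in>{H. dependent_hyperplane H}. {A\<in>Pow H. s < card A})"
    proof (intro set_eqI iffI)
      fix A assume "A \<in> \<D>"
      then have "A \<subseteq> E" "Suc (r A) = r E" "r A < card A" "s < card A" by (auto simp: \<D>_def rank)
      then show "A \<in> (\<Union>H\<in>{H. dependent_hyperplane H}. {A\<in>Pow H. s < card A})"
        using obtain_dependent_hyperplane[of A] by (metis (mono_tags, lifting) PowI UN_iff mem_Collect_eq)
    next
      fix A assume "A \<in> (\<Union>H\<in>{H. dependent_hyperplane H}. {A\<in>Pow H. s < card A})"
      then obtain H where H: "H \<subseteq> E" "r H = s" "A \<subseteq> H" "s < card A"
        by (auto simp: dependent_hyperplane_def rank)
      then show "A \<in> \<D>" using lower[of A] rank_mono[of A H] by (auto simp: \<D>_def)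
    qed
  qed simp
  also have "\<dots> = (\<Sum>H | dependent_hyperplane H. \<Sum>A\<in>{A\<in>Pow H. s < card A}. f (card A))"
  proof (rule sum.UNION_disjoint)
    show "\<forall>H\<in>{H. dependent_hyperplane H}. finite {A \<in> Pow H. s < card A}"
      by (simp add: dependent_hyperplane_def fin)
    show "\<forall>H\<in>{H. dependent_hyperplane H}. \<forall>K\<in>{H. dependent_hyperplane H}. H \<noteq> K \<longrightarrow>
      {A \<in> Pow H. s < card A} \<inter> {A \<in> Pow K. s < card A} = {}"
    proof (intro ballI impI equals0I)
      fix H K A
      assume H: "H \<in> {H. dependent_hyperplane H}" "K \<in> {H. dependent_hyperplane H}" "H \<noteq> K"
        and A: "A \<in> {A \<in> Pow H. s < card A} \<inter> {A \<in> Pow K. s < card A}"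
      have "s \<le> r A" using A H by (intro lower) (auto simp: dependent_hyperplane_def)
      then show False
        using dependent_hyperplane_unique[of H K A] H A rank by auto
    qed
  qed (rule finite_dependent_hyperplanes)
  also have "\<dots> = (\<Sum>H | dependent_hyperplane H. binomial_tail (card H) s y)"
  proof (rule sum.cong)
    fix H assume "H \<in> {H. dependent_hyperplane H}"
    then have H: "H \<subseteq> E" by (simp add: dependent_hyperplane_def)
    have "(\<Sum>A\<in>{A\<in>Pow H. s < card A}. f (card A)) = (\<Sum>A\<in>Pow H. f (card A))"
      using fin[OF H] by (intro sum.mono_neutral_left) (auto simp: f_def)
    then show "(\<Sum>A\<in>{A\<in>Pow H. s < card A}. f (card A)) = binomial_tail (card H) s y"
      using tail[OF H] by simp
  qed simp
  finally show ?thesis by (simp only: head tail[OF subset_refl])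
qed

section \<open>Coefficient bounds and convexity of the Tutte polynomial\<close>

lemma (in matroid) convex_on_tutte_line:
  assumes "coloopless" "paving"
  shows "convex_on {0..p} (\<lambda>y. tutte (p - y) y)"
proof (cases "r E")
  case 0
  have "tutte x y = y ^ card E" for x y
  proof -
    have "r A = 0" if "A \<subseteq> E" for A
      using rank_mono[of A E] that 0 by simp
    then have "tutte x y = (\<Sum>A\<in>Pow E. (y - 1) ^ card A)"
      unfolding tutte_def by (intro sum.cong) (auto simp: 0)
    also have "\<dots> = ((y - 1) + 1) ^ card E"
      unfolding binomial_ring by (simp add: sum_Pow_card finite_ground)
    finally show ?thesis by simp
  qed
  moreover have "convex_on {0..p} (\<lambda>y. y ^ card E)"
    by (cases "even (card E)")
      (auto intro: convex_on_subset[OF convex_power_even] convex_on_subset[OF convex_power_odd])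
  ultimately show ?thesis by simp
next
  case (Suc s)
  define N where "N = card E - 2"
  define q where "q = card E - Suc s"
  define \<H> where "\<H> = {H. dependent_hyperplane H}"
  have "Suc s < card E" using coloopless_rank_less_card[OF assms(1)] Suc by simp
  then have card: "card E = Suc s + q" "0 < q" and cardN: "card E = Suc (Suc N)"
    by (auto simp: q_def N_def)
  have fin: "finite \<H>" unfolding \<H>_def by (rule finite_dependent_hyperplanes)
  have cardH: "card H + 2 \<le> card E" if "H \<in> \<H>" for H
    using that dependent_hyperplane_card[OF assms(1)] by (simp add: \<H>_def)
  define w where "w i = real ((N - Suc i) choose (q - 1))" for i
  define u where "u j = real ((N - Suc j) choose s)" for j
  \<comment> \<open>The guard matters for \<open>s = 0\<close>, where the binomial coefficient would
    be 1 even after truncated subtraction.\<close>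
  define \<beta> where "\<beta> j = (\<Sum>H\<in>\<H>. if j < card H then (card H - Suc j) choose s else 0)" for j
  define b where "b j = real (\<beta> j)" for j
  have tail: "binomial_tail (card E) m z = real (Suc N choose m) + real (N choose m) * z
      + (\<Sum>i<N. real ((N - Suc i) choose m) * z ^ (i + 2))" for m z
    unfolding binomial_tail_eq cardN sum.lessThan_Suc_shift by simp
  have hyperplane_sum: "(\<Sum>H\<in>\<H>. binomial_tail (card H) s y) = (\<Sum>j<N. b j * y ^ j)" for y
  proof -
    have "binomial_tail (card H) s y
        = (\<Sum>j<N. real (if j < card H then (card H - Suc j) choose s else 0) * y ^ j)"
      if "H \<in> \<H>" for H
      unfolding binomial_tail_eq using cardH[OF that] cardN
      by (intro sum.mono_neutral_cong_left) auto
    then have "(\<Sum>H\<in>\<H>. binomial_tail (card H) s y)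
        = (\<Sum>H\<in>\<H>. \<Sum>j<N. real (if j < card H then (card H - Suc j) choose s else 0) * y ^ j)"
      by simp
    also have "\<dots> = (\<Sum>j<N. \<Sum>H\<in>\<H>. real (if j < card H then (card H - Suc j) choose s else 0) * y ^ j)"
      by (rule sum.swap)
    finally show ?thesis
      unfolding b_def \<beta>_def of_nat_sum sum_distrib_right .
  qed
  \<comment> \<open>Each dependent hyperplane omits at least two elements, but the set system bound
    needs \<open>d \<le> Suc j\<close>. Hence \<open>d = 2\<close> serves for \<open>j > 0\<close>
    and only \<open>d = 1\<close> for \<open>j = 0\<close>.\<close>
  have bound: "\<beta> j \<le> (card E - d - Suc j) choose s" if d: "d \<le> 2" "d \<le> Suc j" for d j
  proof -
    have "\<beta> j = (\<Sum>H\<in>{H\<in>\<H>. s + Suc j \<le> card H}. (card H - Suc j) choose s)"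
      unfolding \<beta>_def using fin by (intro sum.mono_neutral_cong_right) (auto simp: binomial_eq_0)
    also have "\<dots> \<le> (card E - d - Suc j) choose s"
    proof (rule sum_binomial_almost_disjoint_le)
      show "card H + d \<le> card E" if "H \<in> {H\<in>\<H>. s + Suc j \<le> card H}" for H
        using cardH[of H] that d by simp
      show "card (H \<inter> K) < s"
        if "H \<in> {H\<in>\<H>. s + Suc j \<le> card H}" "K \<in> {H\<in>\<H>. s + Suc j \<le> card H}" "H \<noteq> K" for H K
        using dependent_hyperplane_inter[OF assms(2), of H K] that Suc by (simp add: \<H>_def)
    qed (use d finite_ground in \<open>auto simp: \<H>_def dependent_hyperplane_def\<close>)
    finally show ?thesis .
  qed
  have "convex_on {0..p} (\<lambda>y.
      (real (Suc N choose (q - 1)) - real (card E choose Suc s) + real (N choose (q - 1)) * (p - y)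
        + (\<Sum>i<N. w i * (p - y) ^ (i + 2)))
      + (real (Suc N choose s) + real (N choose s) * y + (\<Sum>j<N. u j * y ^ (j + 2)))
      + ((p - y) * y - (p - y) - y) * (\<Sum>j<N. b j * y ^ j))"
  proof (rule convex_on_paving_form)
    show "b (Suc j) \<le> b j" for j
      unfolding b_def \<beta>_def of_nat_le_iff by (intro sum_mono) (auto intro: binomial_right_mono)
    have "\<not> N < card H" if "H \<in> \<H>" for H
      using cardH[OF that] cardN by simp
    then show "b N = 0" by (simp add: b_def \<beta>_def)
    show "b j \<le> u j" if "0 < j" for j
      using bound[of 2 j] that cardN by (simp add: b_def u_def)
    show "b 0 \<le> u 0 + w 0" if N: "0 < N"
    proof -
      obtain M where M: "N = Suc M" using gr0_implies_Suc[OF N] by blast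
      have q: "q - 1 = Suc M - s" "s \<le> Suc M" using card cardN M by auto
      \<comment> \<open>By Pascal's rule and symmetry, the bound on \<open>b 0\<close> splits into
        the coefficient \<open>u 0\<close> of \<open>y^2\<close> and the coefficient
        \<open>w 0\<close> of \<open>x^2\<close>.\<close>
      have "Suc M choose s \<le> (M choose s) + (M choose (Suc M - s))"
      proof (cases s)
        case (Suc s')
        then have "M choose (Suc M - s) = M choose s'"
          using q(2) binomial_symmetric[of s' M] by simp
        then show ?thesis by (simp add: Suc)
      qed simp
      moreover have "\<beta> 0 \<le> Suc M choose s" using bound[of 1 0] cardN M by simp
      ultimately have "\<beta> 0 \<le> (M choose s) + (M choose (Suc M - s))" by linarith
      then show ?thesis
        using q M unfolding b_def u_def w_def by (simp flip: of_nat_add)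
    qed
  qed (simp add: w_def)
  also have "(\<lambda>y. (real (Suc N choose (q - 1)) - real (card E choose Suc s) + real (N choose (q - 1)) * (p - y)
        + (\<Sum>i<N. w i * (p - y) ^ (i + 2)))
      + (real (Suc N choose s) + real (N choose s) * y + (\<Sum>j<N. u j * y ^ (j + 2)))
      + ((p - y) * y - (p - y) - y) * (\<Sum>j<N. b j * y ^ j)) = (\<lambda>y. tutte (p - y) y)"
    unfolding tutte_paving[OF assms(2) Suc card] \<H>_def[symmetric] hyperplane_sum tail w_def u_def
    by (simp add: algebra_simps)
  finally show ?thesis .
qed

theorem theorem4p9:
  fixes E :: "'a set" and r :: "'a set \<Rightarrow> nat"
    and x1 x2 y1 y2 t :: real
  assumes "matroid E r"
    and "matroid.coloopless E r"
    and "matroid.paving E r"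
    and "0 \<le> x1" and "0 \<le> x2" and "0 \<le> y1" and "0 \<le> y2"
    and "x1 + y1 = x2 + y2"
    and "0 \<le> t" and "t \<le> 1"
  shows "t * matroid.tutte E r x1 y1 + (1 - t) * matroid.tutte E r x2 y2
    \<ge> matroid.tutte E r (t * x1 + (1 - t) * x2) (t * y1 + (1 - t) * y2)"
proof -
  define p where "p = x1 + y1"
  have x: "x1 = p - y1" "x2 = p - y2" using assms(8) by (auto simp: p_def)
  have "t * x1 + (1 - t) * x2 = p - (t * y1 + (1 - t) * y2)"
    unfolding x by (simp add: algebra_simps)
  \<comment> \<open>Nonnegativity of \<open>x1\<close> and \<open>x2\<close> places
    \<open>y1\<close> and \<open>y2\<close> in \<open>{0..p}\<close>. The parameter is
    \<open>1 - t\<close> because \<open>convex_onD\<close> attaches its parameter to the second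
    point.\<close>
  then show ?thesis
    using convex_onD[OF matroid.convex_on_tutte_line[OF assms(1-3)], of "1 - t" y1 p y2] assms(4-10) x
    by simp
qed

end
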